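(* Suppose that the periodic boundary-value problem $$x_k'(t)=\sqrt{\lambda_k}\,y_k(t),\qquad y_k'(t)=-\sqrt{\lambda_k}\,x_k(t)+\frac{\varepsilon}{\sqrt{\lambda_k}}\Big(1-\sum_{j=1}^\infty x_j^2(t)\Big)y_k(t),\qquad k\in\mathbb N,$$ $$x_k(0)=x_k(w),\quad y_k(0)=y_k(w),\qquad k\in\mathbb N,$$ with $w=2\pi$, $\lambda_k=k^2$, has a solution (for small $\varepsilon$, depending continuously on $\varepsilon$) which for $\varepsilon=0$ turns into the solution $$x_k^0(t)=c_1^k\cos kt+c_2^k\sin kt,\qquad y_k^0(t)=-c_1^k\sin kt+c_2^k\cos kt,\qquad k\in\mathbb N,$$ of the generating problem ($\varepsilon=0$) with the set of pairs of real constants $(c_1^k,c_2^k)$, $k\in\mathbb N$. Then at most finitely many of these pairs are nonzero. Moreover, if $(c_1^{k_i},c_2^{k_i})\neq(0,0)$, $i=1,\dots,N$, are the nonzero pairs, then these constants lie on the $N$-dimensional torus $$\big(c_1^{k_i}\big)^2+\big(c_2^{k_i}\big)^2=\Big(\frac{2}{\sqrt{2N-1}}\Big)^2,\qquad i=1,\dots,N.$$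
   Context: The system is the coordinate form, in a separable Hilbert space $\mathcal H$ with orthonormal basis $\{e_k\}$, of the $w$-periodic problem for an abstract Van der Pol equation $y''+Ty=\varepsilon(1-\|y\|^2)y'$, where $Te_k=\lambda_ke_k$ and $T^{-1}$ is compact; $x_k$ are the coordinates of $y$ and $y_k$ the coordinates of $y'$ divided by $\sqrt{\lambda_k}$. The critical case $\lambda_k=4\pi^2k^2/w^2$ with $w=2\pi$ is considered. Solutions are $C^1$ functions of $t\in[0,2\pi]$ whose coordinate sequences $(x_k(t))_k,(y_k(t))_k$ lie in $\ell_2$. "For $\varepsilon=0$ turns into" means that the solution depends continuously on the small parameter $\varepsilon$ (uniformly in $t\in[0,2\pi]$, in $\ell_2$) and coincides at $\varepsilon=0$ with the indicated generating solution. The generating problem is $x_k'=\sqrt{\lambda_k}y_k$, $y_k'=-\sqrt{\lambda_k}x_k$, $x_k(0)=x_k(w)$, $y_k(0)=y_k(w)$. *)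

theory Defs
  imports "HOL-Analysis.Analysis"
begin

text \<open>
  Coordinate sequences are functions \<open>nat \<Rightarrow> real\<close> of which only the indices \<open>k \<ge> 1\<close> are
  meaningful; the value at index \<open>0\<close> is ignored throughout.
\<close>

definition l2 :: "(nat \<Rightarrow> real) set" where
  "l2 = {a. (\<lambda>k. (a k)\<^sup>2) summable_on {1..}}"

text \<open>Only meaningful on \<^const>\<open>l2\<close>: \<^const>\<open>infsum\<close> is \<open>0\<close> for non-summable families.\<close>

definition l2_norm :: "(nat \<Rightarrow> real) \<Rightarrow> real" where
  "l2_norm a = sqrt (\<Sum>\<^sub>\<infinity>k\<in>{1..}. (a k)\<^sup>2)"

text \<open>
  One-sided derivatives at the endpoints, so that nothing is required outside \<open>S\<close>
  (unlike \<open>C1_differentiable_on\<close>).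
\<close>

definition C1_on :: "real set \<Rightarrow> (real \<Rightarrow> real) \<Rightarrow> bool" where
  "C1_on S f \<longleftrightarrow> (\<exists>f'. continuous_on S f' \<and>
     (\<forall>t\<in>S. (f has_real_derivative f' t) (at t within S)))"

text \<open>
  Here \<open>x t k\<close> and \<open>y t k\<close> are the \<open>k\<close>-th coordinates at time \<open>t\<close>. Smoothness in \<open>t\<close> is required
  coordinatewise.
\<close>

definition vdp_periodic_solution ::
    "real \<Rightarrow> (nat \<Rightarrow> real) \<Rightarrow> real \<Rightarrow> (real \<Rightarrow> nat \<Rightarrow> real) \<Rightarrow> (real \<Rightarrow> nat \<Rightarrow> real) \<Rightarrow> bool" where
  "vdp_periodic_solution w lam \<epsilon> x y \<longleftrightarrow>
     (\<forall>t\<in>{0..w}. x t \<in> l2 \<and> y t \<in> l2) \<and>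
     (\<forall>k\<ge>1. C1_on {0..w} (\<lambda>t. x t k) \<and> C1_on {0..w} (\<lambda>t. y t k)) \<and>
     (\<forall>k\<ge>1. \<forall>t\<in>{0..w}.
        ((\<lambda>s. x s k) has_real_derivative sqrt (lam k) * y t k) (at t within {0..w}) \<and>
        ((\<lambda>s. y s k) has_real_derivative
           - sqrt (lam k) * x t k
           + \<epsilon> / sqrt (lam k) * (1 - (\<Sum>\<^sub>\<infinity>j\<in>{1..}. (x t j)\<^sup>2)) * y t k) (at t within {0..w})) \<and>
     (\<forall>k\<ge>1. x 0 k = x w k \<and> y 0 k = y w k)"

text \<open>Continuity of \<open>\<epsilon> \<mapsto> u \<epsilon>\<close> on \<open>E\<close> for the norm of \<^const>\<open>l2\<close>, uniformly in \<open>t \<in> S\<close>.\<close>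

definition l2_continuous_uniformly ::
    "real set \<Rightarrow> real set \<Rightarrow> (real \<Rightarrow> real \<Rightarrow> nat \<Rightarrow> real) \<Rightarrow> bool" where
  "l2_continuous_uniformly E S u \<longleftrightarrow>
     (\<forall>\<epsilon>\<in>E. uniform_limit S (\<lambda>\<epsilon>' t. l2_norm (\<lambda>k. u \<epsilon>' t k - u \<epsilon> t k)) (\<lambda>t. 0) (at \<epsilon> within E))"

end

theory Submission
  imports Defs
begin

text \<open>
  Along a solution, \<open>(x\<^sub>k\<^sup>2 + y\<^sub>k\<^sup>2)' = 2 (\<epsilon>/k) (1 - \<parallel>x\<parallel>\<^sup>2) y\<^sub>k\<^sup>2\<close>, so by periodicity
  \<open>\<integral> (1 - \<parallel>x\<parallel>\<^sup>2) y\<^sub>k\<^sup>2 = 0\<close> for every \<open>\<epsilon> > 0\<close>, and the uniform limit \<open>\<epsilon> \<rightarrow> 0\<close> gives the same identity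
  for the generating solution. With \<open>R\<^sub>k = (c\<^sub>1\<^sup>k)\<^sup>2 + (c\<^sub>2\<^sup>k)\<^sup>2\<close> and \<open>S = \<Sum> R\<^sub>j\<close> the integral evaluates to
  \<open>\<pi> R\<^sub>k (1 - S/2 + R\<^sub>k/4)\<close>. Hence all nonzero \<open>R\<^sub>k\<close> equal \<open>2 S - 4\<close>; as \<open>S\<close> converges there are
  finitely many, say \<open>N\<close>, and \<open>S = N R\<^sub>k\<close> yields \<open>R\<^sub>k = 4 / (2 N - 1)\<close>.
\<close>

section \<open>Integrals under uniform limits\<close>

text \<open>On a bounded box a uniform error \<open>d\<close> changes the integral by at most
  \<open>d\<close> times the volume, so the limit is integrable and its integral is the limit of the
  values \<open>I n\<close>. The filter is arbitrary because two limits are taken below: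
  \<open>\<epsilon>\<close> tending to 0, and finite index sets growing to all of
  \<open>{1..}\<close>.\<close>

lemma has_integral_uniform_limit:
  fixes f :: "'i \<Rightarrow> 'a::euclidean_space \<Rightarrow> 'b::banach"
  assumes lim: "uniform_limit (cbox a b) f g F" and "F \<noteq> bot"
    and int: "\<forall>\<^sub>F n in F. (f n has_integral I n) (cbox a b)"
    and I: "(I \<longlongrightarrow> L) F"
  shows "(g has_integral L) (cbox a b)"
proof -
  have ev: "\<forall>\<^sub>F n in F. (\<forall>x\<in>cbox a b. norm (g x - f n x) \<le> e) \<and> (f n has_integral I n) (cbox a b)"
    if "e > 0" for e
    using uniform_limitD[OF lim that] int
    by eventually_elim (auto simp: dist_norm norm_minus_commute intro: less_imp_le)
  have "g integrable_on cbox a b"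
  proof (rule integrable_uniform_limit)
    fix e :: real assume "e > 0"
    from eventually_happens'[OF \<open>F \<noteq> bot\<close> ev[OF this]]
    show "\<exists>h. (\<forall>x\<in>cbox a b. norm (g x - h x) \<le> e) \<and> h integrable_on cbox a b"
      by blast
  qed
  then obtain J where J: "(g has_integral J) (cbox a b)"
    by blast
  have "(I \<longlongrightarrow> J) F"
  proof (rule tendstoI)
    fix e :: real assume "e > 0"
    define c where "c = measure lborel (cbox a b)"
    have "c \<ge> 0" by (simp add: c_def)
    \<comment> \<open>Adding 1 to the volume keeps the quotient defined for a box of measure zero
      and makes \<open>d * c < e\<close> strict.\<close>
    define d where "d = e / (c + 1)"
    have d: "d > 0" "d * c < e"
      using \<open>e > 0\<close> \<open>c \<ge> 0\<close> by (auto simp: d_def field_simps)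
    show "\<forall>\<^sub>F n in F. dist (I n) J < e"
      using ev[OF d(1)]
    proof eventually_elim
      case (elim n)
      have "((\<lambda>x. g x - f n x) has_integral (J - I n)) (cbox a b)"
        using J elim by (intro has_integral_diff) auto
      then have "norm (J - I n) \<le> d * c"
        unfolding c_def using elim d(1) by (intro has_integral_bound) auto
      with d(2) show ?case
        by (simp add: dist_norm norm_minus_commute)
    qed
  qed
  with I \<open>F \<noteq> bot\<close> have "J = L"
    using tendsto_unique by blast
  with J show ?thesis by simp
qed

section \<open>The norm of \<open>l2\<close> and uniform convergence in it\<close>

lemma l2_norm_nonneg: "l2_norm a \<ge> 0"
  unfolding l2_norm_def by (simp add: infsum_nonneg)

lemma l2_norm_power2: "(l2_norm a)\<^sup>2 = (\<Sum>\<^sub>\<infinity>k\<in>{1..}. (a k)\<^sup>2)"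
  unfolding l2_norm_def by (simp add: infsum_nonneg)

lemma l2_diff:
  assumes "a \<in> l2" "b \<in> l2"
  shows "(\<lambda>k. a k - b k) \<in> l2"
proof -
  have "(\<lambda>k. 2 * (a k)\<^sup>2 + 2 * (b k)\<^sup>2) summable_on {1..}"
    using assms unfolding l2_def by (intro summable_on_add summable_on_cmult_right) auto
  moreover have "(a k - b k)\<^sup>2 \<le> 2 * (a k)\<^sup>2 + 2 * (b k)\<^sup>2" for k
    using zero_le_power2[of "a k + b k"] by (simp add: power2_eq_square algebra_simps)
  ultimately show ?thesis
    unfolding l2_def using summable_on_comparison_test[where g = "\<lambda>k. (a k - b k)\<^sup>2"] by simp
qed

lemma abs_le_l2_norm:
  assumes "a \<in> l2" "k \<ge> 1"
  shows "\<bar>a k\<bar> \<le> l2_norm a"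
proof -
  have "(\<Sum>j\<in>{k}. (a j)\<^sup>2) \<le> (\<Sum>\<^sub>\<infinity>j\<in>{1..}. (a j)\<^sup>2)"
    using assms by (intro finite_sum_le_infsum) (auto simp: l2_def)
  then have "\<bar>a k\<bar>\<^sup>2 \<le> (l2_norm a)\<^sup>2"
    unfolding l2_norm_power2 by simp
  then show ?thesis
    using l2_norm_nonneg power2_le_imp_le by blast
qed

text \<open>A termwise weighted arithmetic-geometric inequality replaces the triangle inequality for
  \<open>l2_norm\<close>. Choosing the weight equal to the distance bound \<open>d\<close> makes
  every error term vanish with \<open>d\<close> as long as the norm of \<open>b\<close> stays
  bounded.\<close>

lemma abs_diff_l2_norm_power2_le:
  assumes a: "a \<in> l2" and b: "b \<in> l2" and "d > 0"
    and d: "l2_norm (\<lambda>k. a k - b k) \<le> d"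
  shows "\<bar>(l2_norm a)\<^sup>2 - (l2_norm b)\<^sup>2\<bar> \<le> d\<^sup>2 + d * (l2_norm b)\<^sup>2 + d"
proof -
  define D where "D = (\<Sum>\<^sub>\<infinity>k\<in>{1..}. (a k - b k)\<^sup>2)"
  have sa: "(\<lambda>k. (a k)\<^sup>2) summable_on {1..}" and sb: "(\<lambda>k. (b k)\<^sup>2) summable_on {1..}"
    and sd: "(\<lambda>k. (a k - b k)\<^sup>2) summable_on {1..}"
    using a b l2_diff[OF a b] by (auto simp: l2_def)
  have D: "D \<le> d\<^sup>2"
    using power_mono[OF d l2_norm_nonneg, of 2] by (simp add: l2_norm_power2 D_def)
  have amgm: "\<bar>p\<^sup>2 - q\<^sup>2\<bar> \<le> (1 + 1/d) * (p - q)\<^sup>2 + d * q\<^sup>2" for p q :: real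
  proof -
    have 1: "2 * \<bar>q * (p - q)\<bar> \<le> (p - q)\<^sup>2 / d + d * q\<^sup>2"
    proof -
      have "0 \<le> (\<bar>p - q\<bar> - d * \<bar>q\<bar>)\<^sup>2 / d"
        using \<open>d > 0\<close> by simp
      also have "\<dots> = (p - q)\<^sup>2 / d + d * q\<^sup>2 - 2 * \<bar>q * (p - q)\<bar>"
        unfolding abs_mult power2_diff power_mult_distrib power2_abs
        using \<open>d > 0\<close> by (simp add: diff_divide_distrib add_divide_distrib power2_eq_square)
      finally show ?thesis by simp
    qed
    have "p\<^sup>2 - q\<^sup>2 = (p - q)\<^sup>2 + 2 * (q * (p - q))"
      by (simp add: power2_eq_square algebra_simps)
    then have "\<bar>p\<^sup>2 - q\<^sup>2\<bar> \<le> (p - q)\<^sup>2 + 2 * \<bar>q * (p - q)\<bar>"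
      using zero_le_power2[of "p - q"] by linarith
    also have "\<dots> \<le> (1 + 1/d) * (p - q)\<^sup>2 + d * q\<^sup>2"
      using 1 by (simp add: algebra_simps)
    finally show ?thesis .
  qed
  have sr: "(\<lambda>k. (1 + 1/d) * (a k - b k)\<^sup>2 + d * (b k)\<^sup>2) summable_on {1..}"
    by (intro summable_on_add summable_on_cmult_right sd sb)
  have abs: "(\<lambda>k. norm ((a k)\<^sup>2 - (b k)\<^sup>2)) summable_on {1..}"
    by (rule summable_on_comparison_test[OF sr]) (auto intro: amgm)
  have "\<bar>(l2_norm a)\<^sup>2 - (l2_norm b)\<^sup>2\<bar> = \<bar>\<Sum>\<^sub>\<infinity>k\<in>{1..}. (a k)\<^sup>2 - (b k)\<^sup>2\<bar>"
    unfolding l2_norm_power2 using infsum_add[OF sa, of "\<lambda>k. - (b k)\<^sup>2"] sb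
    by (simp add: infsum_uminus summable_on_uminus)
  also have "\<dots> \<le> (\<Sum>\<^sub>\<infinity>k\<in>{1..}. \<bar>(a k)\<^sup>2 - (b k)\<^sup>2\<bar>)"
    using norm_infsum_bound[OF abs] by simp
  also have "\<dots> \<le> (\<Sum>\<^sub>\<infinity>k\<in>{1..}. (1 + 1/d) * (a k - b k)\<^sup>2 + d * (b k)\<^sup>2)"
    using abs by (intro infsum_mono sr amgm) simp
  also have "\<dots> = (1 + 1/d) * D + d * (l2_norm b)\<^sup>2"
    unfolding l2_norm_power2 D_def
    by (subst infsum_add) (simp_all only: infsum_cmult_right' summable_on_cmult_right sd sb)
  \<comment> \<open>The dangerous coefficient \<open>1/d\<close> meets \<open>D \<le> d^2\<close>,
    leaving only \<open>d\<close>.\<close>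
  also have "\<dots> \<le> (1 + 1/d) * d\<^sup>2 + d * (l2_norm b)\<^sup>2"
    using D \<open>d > 0\<close> by (intro add_right_mono mult_left_mono) auto
  also have "\<dots> = d\<^sup>2 + d * (l2_norm b)\<^sup>2 + d"
    using \<open>d > 0\<close> by (simp add: field_simps power2_eq_square)
  finally show ?thesis .
qed

text \<open>Squaring is uniformly continuous only on bounded sets; the bound \<open>B\<close>,
  uniform in \<open>t\<close>, on the limit family makes the preceding estimate uniform.\<close>

lemma uniform_limit_l2_norm_power2:
  assumes lim: "uniform_limit T (\<lambda>n t. l2_norm (\<lambda>k. u n t k - v t k)) (\<lambda>_. 0) F"
    and u: "\<forall>\<^sub>F n in F. \<forall>t\<in>T. u n t \<in> l2"
    and v: "\<And>t. t \<in> T \<Longrightarrow> v t \<in> l2"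
    and B: "\<And>t. t \<in> T \<Longrightarrow> (l2_norm (v t))\<^sup>2 \<le> B" and "B \<ge> 0"
  shows "uniform_limit T (\<lambda>n t. (l2_norm (u n t))\<^sup>2) (\<lambda>t. (l2_norm (v t))\<^sup>2) F"
proof (rule uniform_limitI)
  fix e :: real assume "e > 0"
  \<comment> \<open>Since \<open>d \<le> 1\<close>, the error is at most \<open>d * (B + 2)\<close>;
    the constant 3 leaves room for a strict inequality.\<close>
  define d where "d = min 1 (e / (B + 3))"
  have d: "0 < d" "d \<le> 1" and dB: "d * (B + 3) \<le> e"
    using \<open>e > 0\<close> \<open>B \<ge> 0\<close> by (simp_all add: d_def flip: pos_le_divide_eq)
  show "\<forall>\<^sub>F n in F. \<forall>t\<in>T. dist ((l2_norm (u n t))\<^sup>2) ((l2_norm (v t))\<^sup>2) < e"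
    using uniform_limitD[OF lim d(1)] u
  proof eventually_elim
    case (elim n)
    show ?case
    proof
      fix t assume t: "t \<in> T"
      have "l2_norm (\<lambda>k. u n t k - v t k) \<le> d"
        using elim(1) t by (force simp: dist_real_def)
      then have "\<bar>(l2_norm (u n t))\<^sup>2 - (l2_norm (v t))\<^sup>2\<bar> \<le> d\<^sup>2 + d * (l2_norm (v t))\<^sup>2 + d"
        using elim(2) t v d(1) by (intro abs_diff_l2_norm_power2_le) auto
      also have "\<dots> \<le> d * 1 + d * B + d"
        using d B[OF t] by (intro add_mono mult_left_mono) (auto simp: power2_eq_square)
      also have "\<dots> < d * (B + 3)"
        using d(1) by (simp add: algebra_simps)
      finally show "dist ((l2_norm (u n t))\<^sup>2) ((l2_norm (v t))\<^sup>2) < e"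
        using dB by (simp add: dist_real_def)
    qed
  qed
qed

lemma uniform_limit_l2_coordinate:
  assumes lim: "uniform_limit T (\<lambda>n t. l2_norm (\<lambda>k. u n t k - v t k)) (\<lambda>_. 0) F"
    and u: "\<forall>\<^sub>F n in F. \<forall>t\<in>T. u n t \<in> l2"
    and v: "\<And>t. t \<in> T \<Longrightarrow> v t \<in> l2"
    and "k \<ge> 1"
  shows "uniform_limit T (\<lambda>n t. u n t k) (\<lambda>t. v t k) F"
proof (rule uniform_limitI)
  fix e :: real assume "e > 0"
  show "\<forall>\<^sub>F n in F. \<forall>t\<in>T. dist (u n t k) (v t k) < e"
    using uniform_limitD[OF lim \<open>e > 0\<close>] u
  proof eventually_elim
    case (elim n)
    show ?case
    proof
      fix t assume t: "t \<in> T"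
      have "\<bar>u n t k - v t k\<bar> \<le> l2_norm (\<lambda>k. u n t k - v t k)"
        using abs_le_l2_norm[OF l2_diff \<open>k \<ge> 1\<close>, of "u n t" "v t"] elim(2) t v by auto
      then show "dist (u n t k) (v t k) < e"
        using elim(1) t by (force simp: dist_real_def)
    qed
  qed
qed

section \<open>Energy balance of one mode over a period\<close>

text \<open>In the derivative of the energy of mode \<open>k\<close> the rotation terms cancel and
  only the damping remains, proportional to \<open>\<epsilon>\<close>. Dividing by
  \<open>\<epsilon>\<close> leaves an identity without explicit \<open>\<epsilon>\<close>, which
  still carries information in the limit \<open>\<epsilon>\<close> to 0.\<close>

lemma vdp_energy_identity:
  assumes sol: "vdp_periodic_solution w (\<lambda>k. (real k)\<^sup>2) \<epsilon> x y"
    and "w \<ge> 0" "\<epsilon> \<noteq> 0" "k \<ge> 1"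
  shows "((\<lambda>t. (1 - (l2_norm (x t))\<^sup>2) * (y t k)\<^sup>2) has_integral 0) {0..w}"
proof -
  let ?g = "\<lambda>t. (1 - (l2_norm (x t))\<^sup>2) * (y t k)\<^sup>2"
  have k: "real k > 0" using \<open>k \<ge> 1\<close> by simp
  have dx: "((\<lambda>s. x s k) has_real_derivative real k * y t k) (at t within {0..w})"
    and dy: "((\<lambda>s. y s k) has_real_derivative
      - real k * x t k + \<epsilon> / real k * (1 - (l2_norm (x t))\<^sup>2) * y t k) (at t within {0..w})"
    if "t \<in> {0..w}" for t
    using sol that \<open>k \<ge> 1\<close> by (auto simp: vdp_periodic_solution_def l2_norm_power2)
  have "((\<lambda>s. (x s k)\<^sup>2 + (y s k)\<^sup>2) has_real_derivative 2 * \<epsilon> / real k * ?g t) (at t within {0..w})"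
    if "t \<in> {0..w}" for t
    by (rule derivative_eq_intros dx[OF that] dy[OF that] refl)+
      (use k in \<open>simp add: field_simps power2_eq_square\<close>)
  \<comment> \<open>The integrand is a derivative at every point of the interval, so its gauge
    integral exists by the fundamental theorem; continuity in \<open>t\<close> of the infinite sum
    does not have to be established.\<close>
  then have "((\<lambda>t. 2 * \<epsilon> / real k * ?g t) has_integral
      ((x w k)\<^sup>2 + (y w k)\<^sup>2) - ((x 0 k)\<^sup>2 + (y 0 k)\<^sup>2)) {0..w}"
    using \<open>w \<ge> 0\<close>
    by (intro fundamental_theorem_of_calculus)
      (auto simp: has_real_derivative_iff_has_vector_derivative)
  moreover have "x w k = x 0 k" "y w k = y 0 k"
    using sol \<open>k \<ge> 1\<close> by (auto simp: vdp_periodic_solution_def)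
  ultimately have "((\<lambda>t. 2 * \<epsilon> / real k * ?g t) has_integral 0) {0..w}"
    by simp
  from has_integral_mult_right[OF this, of "real k / (2 * \<epsilon>)"] show ?thesis
    using k \<open>\<epsilon> \<noteq> 0\<close> by simp
qed

section \<open>Trigonometric integrals over \<open>{0..2 * pi}\<close>\<close>

text \<open>For \<open>m \<noteq> 0\<close> the antiderivative is \<open>2 * pi\<close>-periodic.
  The frequency is an integer-valued real, so that differences of frequencies, possibly negative or
  zero, are covered.\<close>

lemma has_integral_cos_sin:
  fixes m :: real
  assumes "m \<in> \<int>"
  shows "((\<lambda>t. p * cos (m * t) + q * sin (m * t)) has_integral (if m = 0 then 2 * pi * p else 0))
    {0..2 * pi}"
proof (cases "m = 0")
  case True
  have "((\<lambda>t. p) has_integral (2 * pi) * p) {0..2 * pi}"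
    using has_integral_const_real[of p 0 "2 * pi"] by simp
  with True show ?thesis by simp
next
  case False
  let ?G = "\<lambda>t. (p * sin (m * t) - q * cos (m * t)) / m"
  have "(?G has_real_derivative p * cos (m * t) + q * sin (m * t)) (at t within {0..2 * pi})" for t
    using False by (auto intro!: derivative_eq_intros simp: field_simps)
  then have "((\<lambda>t. p * cos (m * t) + q * sin (m * t)) has_integral ?G (2 * pi) - ?G 0) {0..2 * pi}"
    by (intro fundamental_theorem_of_calculus)
      (auto simp: has_real_derivative_iff_has_vector_derivative)
  moreover have "sin (m * (2 * pi)) = 0" "cos (m * (2 * pi)) = 1"
    using assms sin_integer_2pi[of m] cos_integer_2pi[of m] by (simp_all add: mult_ac)
  ultimately show ?thesis
    using False by simp
qed

text \<open>The product formulas split the integrand into the frequencies \<open>m + n\<close> and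
  \<open>m - n\<close>. The first is never zero for positive \<open>m\<close> and \<open>n\<close>,
  so a contribution arises only from \<open>m = n\<close>.\<close>

lemma has_integral_cos_sin_mult:
  fixes m n :: nat
  assumes "m > 0" "n > 0"
  shows "((\<lambda>t. (p * cos (real m * t) + q * sin (real m * t)) * (r * cos (real n * t) + s * sin (real n * t)))
    has_integral (if m = n then pi * (p * r + q * s) else 0)) {0..2 * pi}"
proof -
  let ?P = "\<lambda>t. ((p * r - q * s) / 2) * cos ((real m + real n) * t)
    + ((p * s + q * r) / 2) * sin ((real m + real n) * t)"
  let ?M = "\<lambda>t. ((p * r + q * s) / 2) * cos ((real m - real n) * t)
    + ((q * r - p * s) / 2) * sin ((real m - real n) * t)"
  have "((\<lambda>t. ?P t + ?M t) has_integral
    (if real m + real n = 0 then 2 * pi * ((p * r - q * s) / 2) else 0)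
    + (if real m - real n = 0 then 2 * pi * ((p * r + q * s) / 2) else 0)) {0..2 * pi}"
    by (intro has_integral_add has_integral_cos_sin) auto
  also have "(\<lambda>t. ?P t + ?M t) =
    (\<lambda>t. (p * cos (real m * t) + q * sin (real m * t)) * (r * cos (real n * t) + s * sin (real n * t)))"
    by (rule ext) (simp add: distrib_right left_diff_distrib cos_add sin_add cos_diff sin_diff field_simps)
  also have "(if real m + real n = 0 then 2 * pi * ((p * r - q * s) / 2) else 0)
    + (if real m - real n = 0 then 2 * pi * ((p * r + q * s) / 2) else 0)
    = (if m = n then pi * (p * r + q * s) else 0)"
    using assms by auto
  finally show ?thesis .
qed

text \<open>Splits a squared oscillation into its mean and a part of doubled frequency, to which
  orthogonality applies.\<close>

lemma cos_sin_power2: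
  fixes a b \<theta> :: real
  shows "(a * cos \<theta> + b * sin \<theta>)\<^sup>2
    = (a\<^sup>2 + b\<^sup>2) / 2 + ((a\<^sup>2 - b\<^sup>2) / 2 * cos (2 * \<theta>) + a * b * sin (2 * \<theta>))"
proof -
  have s: "(sin \<theta>)\<^sup>2 = 1 - (cos \<theta>)\<^sup>2" by (simp add: sin_squared_eq)
  show ?thesis
    unfolding cos_double_cos sin_double power2_sum power_mult_distrib s by (simp add: field_simps)
qed

lemma cos_sin_rotation_power2:
  fixes a b \<theta> :: real
  shows "(a * cos \<theta> + b * sin \<theta>)\<^sup>2 + (- a * sin \<theta> + b * cos \<theta>)\<^sup>2 = a\<^sup>2 + b\<^sup>2"
proof -
  have s: "(sin \<theta>)\<^sup>2 = 1 - (cos \<theta>)\<^sup>2" by (simp add: sin_squared_eq)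
  show ?thesis
    unfolding power2_sum power_mult_distrib s by (simp add: algebra_simps)
qed

text \<open>With the squares written as \<open>A + U\<close> and \<open>B + V\<close>, where
  \<open>U\<close> and \<open>V\<close> have mean zero and frequencies \<open>2 * j\<close> and
  \<open>2 * k\<close>, the mixed terms integrate to zero. The product \<open>U * V\<close>
  contributes only in the resonant case \<open>j = k\<close>.\<close>

lemma has_integral_cos_sin_power2_mult:
  fixes a b c d :: real and j k :: nat
  assumes "j > 0" "k > 0"
  shows "((\<lambda>t. (a * cos (real j * t) + b * sin (real j * t))\<^sup>2 * (- c * sin (real k * t) + d * cos (real k * t))\<^sup>2)
    has_integral pi * ((a\<^sup>2 + b\<^sup>2) * (c\<^sup>2 + d\<^sup>2) / 2
      + (if j = k then (a\<^sup>2 - b\<^sup>2) * (d\<^sup>2 - c\<^sup>2) / 4 - a * b * c * d else 0))) {0..2 * pi}"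
proof -
  define p q r s where pq: "p = (a\<^sup>2 - b\<^sup>2) / 2" "q = a * b" "r = (d\<^sup>2 - c\<^sup>2) / 2" "s = - (c * d)"
  define A B where AB: "A = (a\<^sup>2 + b\<^sup>2) / 2" "B = (c\<^sup>2 + d\<^sup>2) / 2"
  define U where "U = (\<lambda>t. p * cos (real (2 * j) * t) + q * sin (real (2 * j) * t))"
  define V where "V = (\<lambda>t. r * cos (real (2 * k) * t) + s * sin (real (2 * k) * t))"
  have UV: "((\<lambda>t. U t * V t) has_integral (if 2 * j = 2 * k then pi * (p * r + q * s) else 0)) {0..2 * pi}"
    unfolding U_def V_def by (rule has_integral_cos_sin_mult) (use assms in auto)
  have U: "(U has_integral 0) {0..2 * pi}"
    unfolding U_def using has_integral_cos_sin[of "real (2 * j)" p q] assms by simp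
  have V: "(V has_integral 0) {0..2 * pi}"
    unfolding V_def using has_integral_cos_sin[of "real (2 * k)" r s] assms by simp
  have C: "((\<lambda>t. A * B) has_integral 2 * pi * (A * B)) {0..2 * pi}"
    using has_integral_const_real[of "A * B" 0 "2 * pi"] by simp
  have "((\<lambda>t. A * B + B * U t + A * V t + U t * V t) has_integral
    2 * pi * (A * B) + B * 0 + A * 0 + (if 2 * j = 2 * k then pi * (p * r + q * s) else 0)) {0..2 * pi}"
    by (intro has_integral_add has_integral_mult_right C U V UV)
  moreover have "(a * cos (real j * t) + b * sin (real j * t))\<^sup>2 = A + U t" for t
    using cos_sin_power2[of a "real j * t" b] by (simp add: U_def AB pq mult.assoc)
  moreover have "(- c * sin (real k * t) + d * cos (real k * t))\<^sup>2 = B + V t" for t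
    using cos_sin_power2[of d "real k * t" "- c"]
    by (simp add: V_def AB pq mult.assoc add.commute mult.commute[of c d])
  ultimately have "((\<lambda>t. (a * cos (real j * t) + b * sin (real j * t))\<^sup>2 * (- c * sin (real k * t) + d * cos (real k * t))\<^sup>2)
    has_integral 2 * pi * (A * B) + (if 2 * j = 2 * k then pi * (p * r + q * s) else 0)) {0..2 * pi}"
    by (simp add: algebra_simps)
  also have "2 * pi * (A * B) + (if 2 * j = 2 * k then pi * (p * r + q * s) else 0) =
    pi * ((a\<^sup>2 + b\<^sup>2) * (c\<^sup>2 + d\<^sup>2) / 2
      + (if j = k then (a\<^sup>2 - b\<^sup>2) * (d\<^sup>2 - c\<^sup>2) / 4 - a * b * c * d else 0))"
    by (simp add: AB pq algebra_simps)
  finally show ?thesis .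
qed

lemma has_integral_sin_cos_power2:
  fixes c d :: real and k :: nat
  assumes "k > 0"
  shows "((\<lambda>t. (- c * sin (real k * t) + d * cos (real k * t))\<^sup>2) has_integral pi * (c\<^sup>2 + d\<^sup>2)) {0..2 * pi}"
proof -
  have "((\<lambda>t. (d * cos (real k * t) + (- c) * sin (real k * t)) * (d * cos (real k * t) + (- c) * sin (real k * t)))
    has_integral pi * (d * d + (- c) * (- c))) {0..2 * pi}"
    using has_integral_cos_sin_mult[OF assms assms, of d "- c" d "- c"] by simp
  then show ?thesis
    by (simp add: power2_eq_square algebra_simps)
qed

section \<open>The amplitude equation of the generating solution\<close>

text \<open>The series for the squared norm of \<open>x t\<close> is integrated term by term against
  \<open>(y t)^2\<close>. Every mode \<open>j\<close> contributes \<open>pi * R j * R k / 2\<close>,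
  and the resonance of mode \<open>k\<close> with itself lowers its contribution by
  \<open>pi * (R k)^2 / 4\<close>.\<close>

lemma generating_amplitude_equation:
  fixes c1 c2 :: "nat \<Rightarrow> real"
  defines "R \<equiv> \<lambda>k. (c1 k)\<^sup>2 + (c2 k)\<^sup>2"
  assumes sum: "R summable_on {1..}" and k: "k \<ge> 1"
    and x: "\<And>t j. t \<in> {0..2 * pi} \<Longrightarrow> j \<ge> 1 \<Longrightarrow>
      x t j = c1 j * cos (real j * t) + c2 j * sin (real j * t)"
    and y: "\<And>t. t \<in> {0..2 * pi} \<Longrightarrow> y t = - c1 k * sin (real k * t) + c2 k * cos (real k * t)"
    and int: "((\<lambda>t. (1 - (l2_norm (x t))\<^sup>2) * (y t)\<^sup>2) has_integral 0) {0..2 * pi}"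
  shows "R k * (1 - (\<Sum>\<^sub>\<infinity>j\<in>{1..}. R j) / 2 + R k / 4) = 0"
proof -
  let ?F = "finite_subsets_at_top {1::nat..}"
  let ?I = "\<lambda>F. pi * R k - (\<Sum>j\<in>F. pi * (R j * R k / 2) - (if j = k then pi * (R k * R k / 4) else 0))"
  let ?S = "\<Sum>\<^sub>\<infinity>j\<in>{1..}. R j"
  have y_le: "(y t)\<^sup>2 \<le> R k" if "t \<in> {0..2 * pi}" for t
    using cos_sin_rotation_power2[of "c1 k" "real k * t" "c2 k"]
      zero_le_power2[of "c1 k * cos (real k * t) + c2 k * sin (real k * t)"]
    unfolding y[OF that] R_def by linarith
  have x_le: "(x t j)\<^sup>2 \<le> R j" if "t \<in> {0..2 * pi}" "j \<ge> 1" for t j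
    using cos_sin_rotation_power2[of "c1 j" "real j * t" "c2 j"]
      zero_le_power2[of "- c1 j * sin (real j * t) + c2 j * cos (real j * t)"]
    unfolding x[OF that] R_def by linarith
  have R_nonneg: "R j \<ge> 0" for j by (simp add: R_def)
  \<comment> \<open>The majorant \<open>R j * R k\<close> is independent of \<open>t\<close> and
    summable over \<open>j\<close>, so the finite partial sums converge uniformly.\<close>
  have "uniform_limit {0..2 * pi} (\<lambda>F t. \<Sum>j\<in>F. (x t j)\<^sup>2 * (y t)\<^sup>2)
    (\<lambda>t. \<Sum>\<^sub>\<infinity>j\<in>{1..}. (x t j)\<^sup>2 * (y t)\<^sup>2) ?F"
  proof (rule Weierstrass_m_test_general)
    show "norm ((x t j)\<^sup>2 * (y t)\<^sup>2) \<le> R j * R k" if "j \<in> {1..}" "t \<in> {0..2 * pi}" for j t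
      using x_le[of t j] y_le[of t] that R_nonneg by (auto intro!: mult_mono)
  qed (intro summable_on_cmult_left sum)
  then have "uniform_limit {0..2 * pi} (\<lambda>F t. (y t)\<^sup>2 - (\<Sum>j\<in>F. (x t j)\<^sup>2 * (y t)\<^sup>2))
    (\<lambda>t. (y t)\<^sup>2 - (\<Sum>\<^sub>\<infinity>j\<in>{1..}. (x t j)\<^sup>2 * (y t)\<^sup>2)) ?F"
    by (intro uniform_limit_minus uniform_limit_const)
  moreover have "(y t)\<^sup>2 - (\<Sum>\<^sub>\<infinity>j\<in>{1..}. (x t j)\<^sup>2 * (y t)\<^sup>2) = (1 - (l2_norm (x t))\<^sup>2) * (y t)\<^sup>2" for t
    by (simp add: l2_norm_power2 infsum_cmult_left' left_diff_distrib)
  ultimately have lim: "uniform_limit (cbox 0 (2 * pi)) (\<lambda>F t. (y t)\<^sup>2 - (\<Sum>j\<in>F. (x t j)\<^sup>2 * (y t)\<^sup>2))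
    (\<lambda>t. (1 - (l2_norm (x t))\<^sup>2) * (y t)\<^sup>2) ?F"
    by (simp only: interval_cbox)
  have yint: "((\<lambda>t. (y t)\<^sup>2) has_integral pi * R k) {0..2 * pi}"
    using has_integral_sin_cos_power2[of k "c1 k" "c2 k"] k
    by (subst has_integral_cong[OF arg_cong[where f = "\<lambda>z. z\<^sup>2", OF y]]) (simp_all add: R_def)
  have jint: "((\<lambda>t. (x t j)\<^sup>2 * (y t)\<^sup>2) has_integral
    pi * (R j * R k / 2) - (if j = k then pi * (R k * R k / 4) else 0)) {0..2 * pi}" if "j \<ge> 1" for j
  proof -
    have "((\<lambda>t. (x t j)\<^sup>2 * (y t)\<^sup>2) has_integral pi * (R j * R k / 2
      + (if j = k then ((c1 j)\<^sup>2 - (c2 j)\<^sup>2) * ((c2 k)\<^sup>2 - (c1 k)\<^sup>2) / 4 - c1 j * c2 j * c1 k * c2 k else 0)))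
      {0..2 * pi}"
      using has_integral_cos_sin_power2_mult[of j k "c1 j" "c2 j" "c1 k" "c2 k"] k that
      by (subst has_integral_cong[of _ _ "\<lambda>t. (c1 j * cos (real j * t) + c2 j * sin (real j * t))\<^sup>2
            * (- c1 k * sin (real k * t) + c2 k * cos (real k * t))\<^sup>2"]) (simp_all add: R_def x y)
    \<comment> \<open>On the diagonal, \<open>(a^2 - b^2)^2 + 4 * a^2 * b^2 = (a^2 + b^2)^2\<close>
      collapses the correction to \<open>- (R k)^2 / 4\<close>.\<close>
    also have "pi * (R j * R k / 2
      + (if j = k then ((c1 j)\<^sup>2 - (c2 j)\<^sup>2) * ((c2 k)\<^sup>2 - (c1 k)\<^sup>2) / 4 - c1 j * c2 j * c1 k * c2 k else 0))
      = pi * (R j * R k / 2) - (if j = k then pi * (R k * R k / 4) else 0)"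
      by (simp add: R_def power2_eq_square field_simps)
    finally show ?thesis .
  qed
  have fint: "\<forall>\<^sub>F F in ?F. ((\<lambda>t. (y t)\<^sup>2 - (\<Sum>j\<in>F. (x t j)\<^sup>2 * (y t)\<^sup>2)) has_integral ?I F) (cbox 0 (2 * pi))"
  proof (rule eventually_finite_subsets_at_top_weakI)
    fix F :: "nat set" assume "finite F" "F \<subseteq> {1..}"
    then show "((\<lambda>t. (y t)\<^sup>2 - (\<Sum>j\<in>F. (x t j)\<^sup>2 * (y t)\<^sup>2)) has_integral ?I F) (cbox 0 (2 * pi))"
      unfolding interval_cbox[symmetric]
      by (intro has_integral_diff yint has_integral_sum jint) auto
  qed
  have "((\<lambda>F. pi * R k - (pi * ((\<Sum>j\<in>F. R j) * R k / 2) - pi * (R k * R k / 4)))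
    \<longlongrightarrow> pi * R k - (pi * (?S * R k / 2) - pi * (R k * R k / 4))) ?F"
    by (intro tendsto_intros infsum_tendsto sum) simp
  moreover have "\<forall>\<^sub>F F in ?F. pi * R k - (pi * ((\<Sum>j\<in>F. R j) * R k / 2) - pi * (R k * R k / 4)) = ?I F"
  proof -
    \<comment> \<open>Once the finite set contains \<open>k\<close>, the diagonal correction occurs
      in the sum exactly once.\<close>
    have "\<forall>\<^sub>F F in ?F. finite F \<and> {k} \<subseteq> F \<and> F \<subseteq> {1..}"
      unfolding eventually_finite_subsets_at_top using k by (intro exI[of _ "{k}"]) auto
    then show ?thesis
    proof eventually_elim
      case (elim F)
      then show ?case
        by (simp add: sum_subtractf sum_distrib_left sum_distrib_right sum_divide_distrib)
    qed
  qed
  ultimately have "(?I \<longlongrightarrow> pi * R k - (pi * (?S * R k / 2) - pi * (R k * R k / 4))) ?F"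
    by (rule Lim_transform_eventually)
  from has_integral_uniform_limit[OF lim _ fint this]
  have "((\<lambda>t. (1 - (l2_norm (x t))\<^sup>2) * (y t)\<^sup>2) has_integral
    pi * R k - (pi * (?S * R k / 2) - pi * (R k * R k / 4))) {0..2 * pi}"
    by simp
  with int have "pi * R k - (pi * (?S * R k / 2) - pi * (R k * R k / 4)) = 0"
    using has_integral_unique by blast
  then have "pi * (R k * (1 - ?S / 2 + R k / 4)) = 0"
    by (simp add: algebra_simps)
  then show ?thesis by simp
qed

section \<open>Summable families with one nonzero value\<close>

text \<open>A nonzero constant is not summable over an infinite set. If the support is empty,
  \<open>c\<close> is arbitrary and both sides of the sum formula are 0.\<close>

lemma finite_support_if_constant:
  fixes R :: "'i \<Rightarrow> real"
  assumes sum: "R summable_on I" and c: "\<And>k. k \<in> I \<Longrightarrow> R k \<noteq> 0 \<Longrightarrow> R k = c"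
  shows "finite {k\<in>I. R k \<noteq> 0}"
    and "(\<Sum>\<^sub>\<infinity>k\<in>I. R k) = real (card {k\<in>I. R k \<noteq> 0}) * c"
proof -
  let ?A = "{k\<in>I. R k \<noteq> 0}"
  have "R summable_on ?A"
    using sum by (rule summable_on_subset_banach) auto
  then have s: "(\<lambda>_. c) summable_on ?A"
    by (rule summable_on_cong[THEN iffD1, rotated]) (use c in auto)
  show fin: "finite ?A"
  proof (rule ccontr)
    assume inf: "infinite ?A"
    then obtain k where k: "k \<in> ?A" by (metis finite.emptyI ex_in_conv)
    with c have "c \<noteq> 0" by fastforce
    with inf s show False
      using infsum_diverge_constant by blast
  qed
  have "(\<Sum>\<^sub>\<infinity>k\<in>I. R k) = (\<Sum>\<^sub>\<infinity>k\<in>?A. c)"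
    by (rule infsum_cong_neutral) (use c in auto)
  with fin show "(\<Sum>\<^sub>\<infinity>k\<in>I. R k) = real (card ?A) * c"
    by simp
qed

section \<open>The limit \<open>\<epsilon>\<close> to 0 and the resulting torus\<close>

theorem theorem6:
  fixes \<epsilon>0 :: real
    and x y :: "real \<Rightarrow> real \<Rightarrow> nat \<Rightarrow> real"
    and c1 c2 :: "nat \<Rightarrow> real"
  assumes "\<epsilon>0 > 0"
    and "\<And>\<epsilon>. \<epsilon> \<in> {0..\<epsilon>0} \<Longrightarrow>
           vdp_periodic_solution (2 * pi) (\<lambda>k. (real k)\<^sup>2) \<epsilon> (x \<epsilon>) (y \<epsilon>)"
    and "l2_continuous_uniformly {0..\<epsilon>0} {0..2 * pi} x"
    and "l2_continuous_uniformly {0..\<epsilon>0} {0..2 * pi} y"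
    and "\<And>t k. t \<in> {0..2 * pi} \<Longrightarrow> k \<ge> 1 \<Longrightarrow>
           x 0 t k = c1 k * cos (real k * t) + c2 k * sin (real k * t)"
    and "\<And>t k. t \<in> {0..2 * pi} \<Longrightarrow> k \<ge> 1 \<Longrightarrow>
           y 0 t k = - c1 k * sin (real k * t) + c2 k * cos (real k * t)"
  shows "finite {k. k \<ge> 1 \<and> (c1 k, c2 k) \<noteq> (0, 0)} \<and>
    (\<forall>(N::nat) (\<kappa> :: nat \<Rightarrow> nat).
       bij_betw \<kappa> {1..N} {k. k \<ge> 1 \<and> (c1 k, c2 k) \<noteq> (0, 0)} \<longrightarrow>
       (\<forall>i\<in>{1..N}. (c1 (\<kappa> i))\<^sup>2 + (c2 (\<kappa> i))\<^sup>2 = (2 / sqrt (2 * real N - 1))\<^sup>2))"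
proof -
  let ?T = "{0..2 * pi}"
  let ?F = "at 0 within {0..\<epsilon>0}"
  define R where "R = (\<lambda>k. (c1 k)\<^sup>2 + (c2 k)\<^sup>2)"
  define S where "S = (\<Sum>\<^sub>\<infinity>j\<in>{1..}. R j)"
  have xl2: "x \<epsilon> t \<in> l2" and yl2: "y \<epsilon> t \<in> l2" if "\<epsilon> \<in> {0..\<epsilon>0}" "t \<in> ?T" for \<epsilon> t
    using assms(2)[OF that(1)] that(2) by (auto simp: vdp_periodic_solution_def)
  \<comment> \<open>Summability of \<open>R\<close> is read off from the generating state at time 0,
    where both coordinate sequences lie in \<open>l2\<close>.\<close>
  have "(\<lambda>k. (x 0 0 k)\<^sup>2 + (y 0 0 k)\<^sup>2) summable_on {1..}"
    using xl2[of 0 0] yl2[of 0 0] \<open>\<epsilon>0 > 0\<close> by (intro summable_on_add) (auto simp: l2_def)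
  then have R: "R summable_on {1..}"
    by (rule summable_on_cong[THEN iffD1, rotated]) (simp add: R_def assms(5,6))
  \<comment> \<open>The punctured filter excludes \<open>\<epsilon> = 0\<close>, where the energy
    identity could not be divided by \<open>\<epsilon>\<close>.\<close>
  have pos: "\<forall>\<^sub>F \<epsilon> in ?F. \<epsilon> \<in> {0<..\<epsilon>0}"
    using \<open>\<epsilon>0 > 0\<close> by (auto simp: eventually_at_filter)
  have nbot: "?F \<noteq> bot"
    using \<open>\<epsilon>0 > 0\<close> by (simp add: trivial_limit_within)
  have limx: "uniform_limit ?T (\<lambda>\<epsilon> t. l2_norm (\<lambda>k. x \<epsilon> t k - x 0 t k)) (\<lambda>_. 0) ?F"
    and limy: "uniform_limit ?T (\<lambda>\<epsilon> t. l2_norm (\<lambda>k. y \<epsilon> t k - y 0 t k)) (\<lambda>_. 0) ?F"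
    using assms(3,4) \<open>\<epsilon>0 > 0\<close> by (auto simp: l2_continuous_uniformly_def)
  have evx: "\<forall>\<^sub>F \<epsilon> in ?F. \<forall>t\<in>?T. x \<epsilon> t \<in> l2" and evy: "\<forall>\<^sub>F \<epsilon> in ?F. \<forall>t\<in>?T. y \<epsilon> t \<in> l2"
    using pos by (eventually_elim, use xl2 yl2 in force)+
  have R_eq: "(x 0 t k)\<^sup>2 + (y 0 t k)\<^sup>2 = R k" if "t \<in> ?T" "k \<ge> 1" for t k
    unfolding assms(5,6)[OF that] R_def by (rule cos_sin_rotation_power2)
  have xS: "(l2_norm (x 0 t))\<^sup>2 \<le> S" if "t \<in> ?T" for t
    unfolding l2_norm_power2 S_def
  proof (rule infsum_mono)
    show "(\<lambda>k. (x 0 t k)\<^sup>2) summable_on {1..}"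
      using xl2[of 0 t] that \<open>\<epsilon>0 > 0\<close> by (simp add: l2_def)
    show "(x 0 t k)\<^sup>2 \<le> R k" if "k \<in> {1..}" for k
      using R_eq[of t k] \<open>t \<in> ?T\<close> that by (smt (verit) atLeast_iff zero_le_power2)
  qed (fact R)
  have "S \<ge> 0"
    unfolding S_def by (rule infsum_nonneg) (simp add: R_def)
  have amplitude: "R k * (1 - S / 2 + R k / 4) = 0" if "k \<ge> 1" for k
  proof -
    have "uniform_limit ?T (\<lambda>\<epsilon> t. (l2_norm (x \<epsilon> t))\<^sup>2) (\<lambda>t. (l2_norm (x 0 t))\<^sup>2) ?F"
      using \<open>\<epsilon>0 > 0\<close> by (intro uniform_limit_l2_norm_power2[OF limx evx _ xS \<open>S \<ge> 0\<close>] xl2) auto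
    then have lim1: "uniform_limit ?T (\<lambda>\<epsilon> t. 1 - (l2_norm (x \<epsilon> t))\<^sup>2) (\<lambda>t. 1 - (l2_norm (x 0 t))\<^sup>2) ?F"
      by (intro uniform_limit_minus uniform_limit_const)
    have limyk: "uniform_limit ?T (\<lambda>\<epsilon> t. y \<epsilon> t k) (\<lambda>t. y 0 t k) ?F"
      using \<open>\<epsilon>0 > 0\<close> that by (intro uniform_limit_l2_coordinate[OF limy evy] yl2) auto
    \<comment> \<open>Uniform limits may be multiplied when the limit functions are bounded; the
      following bounds by \<open>R k\<close> and \<open>1 + S\<close> supply this for the factors
      \<open>y 0 t k\<close>, their product and \<open>1 - (l2_norm (x 0 t))^2\<close>.\<close>
    have y_le: "(y 0 t k)\<^sup>2 \<le> R k" if "t \<in> ?T" for t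
      using R_eq[of t k] \<open>k \<ge> 1\<close> that by (smt (verit) zero_le_power2)
    have "\<bar>y 0 t k\<bar> \<le> sqrt (R k)" if "t \<in> ?T" for t
      using real_sqrt_le_mono[OF y_le[OF that]] by simp
    then have by1: "bounded ((\<lambda>t. y 0 t k) ` ?T)"
      by (intro boundedI[of _ "sqrt (R k)"]) auto
    have by2: "bounded ((\<lambda>t. y 0 t k * y 0 t k) ` ?T)"
      using y_le by (intro boundedI[of _ "R k"]) (auto simp: power2_eq_square)
    have "\<bar>1 - (l2_norm (x 0 t))\<^sup>2\<bar> \<le> 1 + S" if "t \<in> ?T" for t
      using xS[OF that] \<open>S \<ge> 0\<close> zero_le_power2[of "l2_norm (x 0 t)"] by linarith
    then have bx: "bounded ((\<lambda>t. 1 - (l2_norm (x 0 t))\<^sup>2) ` ?T)"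
      by (intro boundedI[of _ "1 + S"]) auto
    have lim: "uniform_limit (cbox 0 (2 * pi)) (\<lambda>\<epsilon> t. (1 - (l2_norm (x \<epsilon> t))\<^sup>2) * (y \<epsilon> t k)\<^sup>2)
      (\<lambda>t. (1 - (l2_norm (x 0 t))\<^sup>2) * (y 0 t k)\<^sup>2) ?F"
      unfolding power2_eq_square[of "y _ _ k"] interval_cbox[symmetric]
      by (intro uniform_lim_mult lim1 limyk bx by1 by2)
    have "\<forall>\<^sub>F \<epsilon> in ?F. ((\<lambda>t. (1 - (l2_norm (x \<epsilon> t))\<^sup>2) * (y \<epsilon> t k)\<^sup>2) has_integral 0) (cbox 0 (2 * pi))"
      using pos
    proof eventually_elim
      case (elim \<epsilon>)
      then show ?case
        unfolding interval_cbox[symmetric]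
        by (intro vdp_energy_identity[OF assms(2)] that) auto
    qed
    from has_integral_uniform_limit[OF lim nbot this tendsto_const]
    have "((\<lambda>t. (1 - (l2_norm (x 0 t))\<^sup>2) * (y 0 t k)\<^sup>2) has_integral 0) ?T"
      by simp
    then show ?thesis
      using R that unfolding R_def S_def
      by (intro generating_amplitude_equation[where x = "x 0" and y = "\<lambda>t. y 0 t k"]) (auto simp: assms(5,6))
  qed
  have R_const: "R k = 2 * S - 4" if "k \<in> {1..}" "R k \<noteq> 0" for k
    using amplitude[of k] that by simp
  have set: "{k. k \<ge> 1 \<and> (c1 k, c2 k) \<noteq> (0, 0)} = {k\<in>{1..}. R k \<noteq> 0}"
    by (auto simp: R_def sum_power2_eq_zero_iff)
  \<comment> \<open>The common value \<open>2 * S - 4\<close> itself involves \<open>S\<close>, so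
    summing it over the support gives a closed equation for \<open>S\<close>.\<close>
  have card: "S = real (card {k\<in>{1..}. R k \<noteq> 0}) * (2 * S - 4)"
    unfolding S_def by (rule finite_support_if_constant(2)[OF R]) (use R_const S_def in auto)
  show ?thesis
    unfolding set
  proof (intro conjI allI impI ballI)
    show "finite {k\<in>{1..}. R k \<noteq> 0}"
      using R R_const by (rule finite_support_if_constant(1))
    fix N :: nat and \<kappa> :: "nat \<Rightarrow> nat" and i
    assume bij: "bij_betw \<kappa> {1..N} {k\<in>{1..}. R k \<noteq> 0}" and i: "i \<in> {1..N}"
    have "\<kappa> i \<in> {k\<in>{1..}. R k \<noteq> 0}"
      using bij i by (auto dest: bij_betwE)
    then have Ri: "R (\<kappa> i) = 2 * S - 4"
      using R_const by auto
    have "S = real N * (2 * S - 4)"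
      using card bij_betw_same_card[OF bij] by simp
    \<comment> \<open>Since \<open>N * (2 * S - 4) = S\<close>, the product
      \<open>(2 * N - 1) * (2 * S - 4)\<close> equals
      \<open>2 * S - (2 * S - 4) = 4\<close>.\<close>
    then have "(2 * real N - 1) * R (\<kappa> i) = 4"
      unfolding Ri by (simp add: algebra_simps)
    \<comment> \<open>The existence of an index \<open>i\<close> in \<open>{1..N}\<close> forces
      \<open>N \<ge> 1\<close>, so the square root has a positive argument.\<close>
    moreover have "2 * real N - 1 > 0"
      using i by auto
    ultimately show "(c1 (\<kappa> i))\<^sup>2 + (c2 (\<kappa> i))\<^sup>2 = (2 / sqrt (2 * real N - 1))\<^sup>2"
      by (simp add: R_def power_divide field_simps)
  qed
qed

end
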